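(* Let $t_0>0$ and let $r:[t_0,\infty)\to(0,\infty)$ be a wavy function, with $\alpha\in(0,1)$ the value occurring in part (iii) and $\varepsilon>0$ the value occurring in part (ii) of the waviness condition for $r$. Let $\varphi:[t_0,\infty)\to[\varphi_0,\infty)$ be an increasing function of class $C^1$ such that $\varphi(t_0)=\varphi_0>0$, and suppose there exists $\bar\varphi_0\in\mathbb{R}$ such that $$|(\varphi(t)-\bar\varphi_0)-(t-t_0)|\to0\quad\text{as } t\to\infty .$$ Let $f:[\varphi_0,\infty)\to(0,\infty)$ be defined by $f(\varphi(t))=r(t)$, and let $\Gamma'$ be the curve given in polar coordinates by $r=f(\varphi)$, $\varphi\ge\varphi_0$; assume that $\Gamma'$ is a spiral, i.e. $f(\varphi)\to0$ as $\varphi\to\infty$ and, for every fixed $\varphi\ge\varphi_0$, the function $\mathbb{N}\ni k\mapsto f(\varphi+2k\pi)$ is decreasing. Let $\varepsilon'$ satisfy $0<\varepsilon'<\varepsilon$ and put $\theta:=\min\{\varepsilon',\pi\}$. Assume that there exist positive constants $\underline{m},\overline{m},\underline{a}',M$ such that for all $\varphi\ge\varphi_0$ $$\underline{m}\,\varphi^{-\alpha}\le f(\varphi)\le\overline{m}\,\varphi^{-\alpha},\qquad |f'(\varphi)|\le M\varphi^{-\alpha-1},$$ and for all $\varphi\ge\varphi_0$ and all $\triangle\varphi$ with $\theta\le\triangle\varphi\le2\pi+\theta$ $$\underline{a}'\varphi^{-\alpha-1}\le f(\varphi)-f(\varphi+\triangle\varphi).$$ Then $\Gamma'$ is a wavy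 spiral and $$\dim_B\Gamma'=\frac{2}{1+\alpha}.$$
   Context: Wavy function: let $r:[t_0,\infty)\to(0,\infty)$ be $C^1$ with $r'(t_0)\le0$. It is a wavy function if the sequence $(t_n)$ defined inductively by $$t_{2k+1}=\inf\{t:t>t_{2k},\ r'(t)>0\},\qquad t_{2k+2}=\inf\{t:t>t_{2k+1},\ r(t)=r(t_{2k+1})\},\qquad k\in\mathbb{N}_0,$$ is well-defined and satisfies the waviness condition: (i) $(t_n)$ is increasing and $t_n\to\infty$; (ii) there is $\varepsilon>0$ such that $t_{2k+1}-t_{2k}\ge\varepsilon$ for all $k\in\mathbb{N}_0$; (iii) for some $\alpha\in(0,1)$, $\mathrm{osc}_{t\in[t_{2k+1},t_{2k+2}]}r(t)=o(t_{2k+1}^{-\alpha-1})$ as $k\to\infty$, where $\mathrm{osc}_{t\in I}r(t)=\max_{t\in I}r(t)-\min_{t\in I}r(t)$. Wavy spiral: a spiral given in polar coordinates by $r=f(\varphi)$ is a wavy spiral if there exists an increasing or decreasing function $\varphi=\varphi(t)$ of class $C^1$ such that $r(t)=f(\varphi(t))$ is a wavy function. Box dimension: for bounded $A\subset\mathbb{R}^N$ let $A_\varepsilon=\{y\in\mathbb{R}^N: d(y,A)<\varepsilon\}$, and let $|A_\varepsilon|$ denote its Lebesgue measure. For $s\ge0$ let $\mathcal{M}_*^s(A)=\liminf_{\varepsilon\to0}|A_\varepsilon|/\varepsilon^{N-s}$ and $\mathcal{M}^{*s}(A)=\limsup_{\varepsilon\to0}|A_\varepsilon|/\varepsilon^{N-s}$.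 Then $\underline{\dim}_BA=\inf\{s\ge0:\mathcal{M}_*^s(A)=0\}$ and $\overline{\dim}_BA=\inf\{s\ge0:\mathcal{M}^{*s}(A)=0\}$; if they coincide the common value is $\dim_BA$. *)

theory Defs
  imports "HOL-Analysis.Analysis" "HOL-Library.Landau_Symbols"
begin

(* A function on a half-line [a, oo) is a total function whose values left of a are irrelevant:
   derivatives are taken within {a..}, hence are one-sided at a. *)

definition deriv_from :: "real \<Rightarrow> (real \<Rightarrow> real) \<Rightarrow> real \<Rightarrow> real" where
  "deriv_from a f t = vector_derivative f (at t within {a..})"

definition C1_from :: "real \<Rightarrow> (real \<Rightarrow> real) \<Rightarrow> bool" where
  "C1_from a f \<longleftrightarrow> f differentiable_on {a..} \<and> continuous_on {a..} (deriv_from a f)"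

definition osc :: "('a \<Rightarrow> real) \<Rightarrow> 'a set \<Rightarrow> real" where
  "osc f S = Sup (f ` S) - Inf (f ` S)"

(* The set whose infimum is the (n+1)-st term, given that s is the n-th term: for even n the later
   points where the derivative is positive, for odd n the later points where r returns to r s. *)

definition wavy_next :: "real \<Rightarrow> (real \<Rightarrow> real) \<Rightarrow> nat \<Rightarrow> real \<Rightarrow> real set" where
  "wavy_next t0 r n s =
     (if even n then {t. t > s \<and> deriv_from t0 r t > 0} else {t. t > s \<and> r t = r s})"

primrec wavy_seq :: "real \<Rightarrow> (real \<Rightarrow> real) \<Rightarrow> nat \<Rightarrow> real" where
  "wavy_seq t0 r 0 = t0"
| "wavy_seq t0 r (Suc n) = Inf (wavy_next t0 r n (wavy_seq t0 r n))"

(* Each wavy_next set is bounded below, so the sequence is well-defined as soon as these sets are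
   nonempty. "Increasing" is strict: the weak form holds for any well-defined sequence. *)

definition wavy_function_with :: "real \<Rightarrow> (real \<Rightarrow> real) \<Rightarrow> real \<Rightarrow> real \<Rightarrow> bool" where
  "wavy_function_with t0 r \<epsilon> \<alpha> \<longleftrightarrow>
     (\<forall>t\<ge>t0. r t > 0) \<and> C1_from t0 r \<and> deriv_from t0 r t0 \<le> 0 \<and>
     (\<forall>n. wavy_next t0 r n (wavy_seq t0 r n) \<noteq> {}) \<and>
     strict_mono (wavy_seq t0 r) \<and> filterlim (wavy_seq t0 r) at_top sequentially \<and>
     \<epsilon> > 0 \<and> (\<forall>k. wavy_seq t0 r (2 * k + 1) - wavy_seq t0 r (2 * k) \<ge> \<epsilon>) \<and>
     0 < \<alpha> \<and> \<alpha> < 1 \<and>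
     (\<lambda>k. osc r {wavy_seq t0 r (2 * k + 1)..wavy_seq t0 r (2 * k + 2)})
       \<in> o(\<lambda>k. wavy_seq t0 r (2 * k + 1) powr (-\<alpha> - 1))"

definition wavy_function :: "real \<Rightarrow> (real \<Rightarrow> real) \<Rightarrow> bool" where
  "wavy_function t0 r \<longleftrightarrow> (\<exists>\<epsilon> \<alpha>. wavy_function_with t0 r \<epsilon> \<alpha>)"

definition polar_curve :: "real \<Rightarrow> (real \<Rightarrow> real) \<Rightarrow> complex set" where
  "polar_curve \<phi>0 f = (\<lambda>\<phi>. rcis (f \<phi>) \<phi>) ` {\<phi>0..}"

(* The index set of the sequence along a ray is the positive integers. *)

definition spiral :: "real \<Rightarrow> (real \<Rightarrow> real) \<Rightarrow> bool" where
  "spiral \<phi>0 f \<longleftrightarrow>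
     (\<forall>\<phi>\<ge>\<phi>0. f \<phi> > 0) \<and> (f \<longlongrightarrow> 0) at_top \<and>
     (\<forall>\<phi>\<ge>\<phi>0. strict_antimono_on {1..} (\<lambda>k::nat. f (\<phi> + 2 * real k * pi)))"

definition wavy_spiral :: "real \<Rightarrow> (real \<Rightarrow> real) \<Rightarrow> bool" where
  "wavy_spiral \<phi>0 f \<longleftrightarrow>
     spiral \<phi>0 f \<and>
     (\<exists>t0 \<phi>. C1_from t0 \<phi> \<and> (strict_mono_on {t0..} \<phi> \<or> strict_antimono_on {t0..} \<phi>) \<and>
        \<phi> ` {t0..} \<subseteq> {\<phi>0..} \<and> wavy_function t0 (\<lambda>t. f (\<phi> t)))"

definition nbhd :: "'a::metric_space set \<Rightarrow> real \<Rightarrow> 'a set" where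
  "nbhd A \<epsilon> = {y. infdist y A < \<epsilon>}"

definition lower_minkowski_content :: "real \<Rightarrow> 'a::euclidean_space set \<Rightarrow> ennreal" where
  "lower_minkowski_content s A =
     Liminf (at_right 0)
       (\<lambda>\<epsilon>. emeasure lebesgue (nbhd A \<epsilon>) / ennreal (\<epsilon> powr (real DIM('a) - s)))"

definition upper_minkowski_content :: "real \<Rightarrow> 'a::euclidean_space set \<Rightarrow> ennreal" where
  "upper_minkowski_content s A =
     Limsup (at_right 0)
       (\<lambda>\<epsilon>. emeasure lebesgue (nbhd A \<epsilon>) / ennreal (\<epsilon> powr (real DIM('a) - s)))"

definition lower_box_dim :: "'a::euclidean_space set \<Rightarrow> real" where
  "lower_box_dim A = Inf {s. 0 \<le> s \<and> lower_minkowski_content s A = 0}"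

definition upper_box_dim :: "'a::euclidean_space set \<Rightarrow> real" where
  "upper_box_dim A = Inf {s. 0 \<le> s \<and> upper_minkowski_content s A = 0}"

definition has_box_dim :: "'a::euclidean_space set \<Rightarrow> real \<Rightarrow> bool" where
  "has_box_dim A d \<longleftrightarrow> bounded A \<and> lower_box_dim A = d \<and> upper_box_dim A = d"

end

theory Submission
  imports Defs "HOL-Real_Asymp.Real_Asymp"
begin

text \<open>
  That the curve is a wavy spiral comes from the given reparametrisation: \<open>f \<circ> \<phi>\<close> agrees with the wavy
  function \<open>r\<close> on \<open>{t0..}\<close>, and being wavy depends on the values there alone
  (\<open>wavy_function_with_cong\<close>).

  For the dimension \<open>d = 2 / (1 + \<alpha>)\<close>, the area of the \<open>\<epsilon>\<close>-neighbourhood is shown to lie between two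
  constant multiples of \<open>\<epsilon> powr (2 - d)\<close> for small \<open>\<epsilon>\<close>, which determines both box dimensions
  (\<open>has_box_dim_if_nbhd_bounds\<close>). Consecutive turns near the angle \<open>x\<close> are at radial distance at most
  \<open>2 * pi * M * x powr (- \<alpha> - 1)\<close>. This drops below \<open>\<epsilon>\<close> when \<open>x\<close> exceeds an angle \<open>T\<close> of order
  \<open>\<epsilon> powr (- 1 / (1 + \<alpha>))\<close>. The turns beyond \<open>T\<close> form the nucleus and the turns before it the
  tail of the neighbourhood.

  Lower bound (\<open>nbhd_lower\<close>): the turns beyond \<open>T\<close> are so dense that the neighbourhood contains a full
  disc, whose radius, like the least distance from the origin along the turn starting at \<open>T\<close>, is of
  order \<open>T powr - \<alpha>\<close>. Its area is of order
  \<open>T powr (- 2 * \<alpha>)\<close>, that is \<open>\<epsilon> powr (2 * \<alpha> / (1 + \<alpha>)) = \<epsilon> powr (2 - d)\<close>.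

  Upper bound (\<open>nbhd_upper\<close>): the neighbourhood of the nucleus lies in a disc of radius of the same order.
  The speed at the angle \<open>x\<close> is of order \<open>x powr - \<alpha>\<close>, so the tail has length of order
  \<open>T powr (1 - \<alpha>)\<close> and a neighbourhood of area of order \<open>\<epsilon> * T powr (1 - \<alpha>)\<close>. This is again
  of order \<open>\<epsilon> powr (2 - d)\<close>.
\<close>

section \<open>Wavy functions depend only on their values on the half-line\<close>

lemma deriv_from_cong:
  assumes "\<And>t. t \<ge> a \<Longrightarrow> f t = g t" and "t \<ge> a"
  shows "deriv_from a f t = deriv_from a g t"
proof -
  have "(f has_vector_derivative D) (at t within {a..}) \<longleftrightarrow>
        (g has_vector_derivative D) (at t within {a..})" for D
    using assms by (auto intro: has_vector_derivative_transform[rotated 2])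
  then show ?thesis
    unfolding deriv_from_def vector_derivative_def by simp
qed

lemma C1_from_cong:
  assumes "\<And>t. t \<ge> a \<Longrightarrow> f t = g t"
  shows "C1_from a f \<longleftrightarrow> C1_from a g"
proof -
  have "f differentiable_on {a..} \<longleftrightarrow> g differentiable_on {a..}"
    using assms by (auto simp: differentiable_on_def intro: differentiable_transform_within[OF _ zero_less_one])
  moreover have "continuous_on {a..} (deriv_from a f) \<longleftrightarrow> continuous_on {a..} (deriv_from a g)"
    using deriv_from_cong[OF assms] by (intro continuous_on_cong) auto
  ultimately show ?thesis
    by (simp add: C1_from_def)
qed

lemma wavy_next_cong:
  assumes "\<And>t. t \<ge> t0 \<Longrightarrow> f t = g t" and "s \<ge> t0"
  shows "wavy_next t0 f n s = wavy_next t0 g n s"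
proof -
  have t: "f t = g t" "deriv_from t0 f t = deriv_from t0 g t" if "s < t" for t
    using that assms by (auto intro: deriv_from_cong)
  have "f s = g s"
    using assms by blast
  then show ?thesis
    unfolding wavy_next_def by (simp add: t cong: conj_cong)
qed

lemma wavy_function_with_cong:
  assumes eq: "\<And>t. t \<ge> t0 \<Longrightarrow> f t = g t" and wavy: "wavy_function_with t0 g \<epsilon> \<alpha>"
  shows "wavy_function_with t0 f \<epsilon> \<alpha>"
proof -
  have "strict_mono (wavy_seq t0 g)"
    using wavy by (simp add: wavy_function_with_def)
  then have ge: "t0 \<le> wavy_seq t0 g n" for n
    using strict_mono_leD[of "wavy_seq t0 g" 0 n] by simp
  have seq: "wavy_seq t0 f n = wavy_seq t0 g n" for n
    by (induction n) (simp_all add: wavy_next_cong[OF eq ge])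
  have osc: "osc f {wavy_seq t0 g m..b} = osc g {wavy_seq t0 g m..b}" for m b
  proof -
    have "f t = g t" if "t \<in> {wavy_seq t0 g m..b}" for t
      using that ge[of m] by (intro eq) auto
    then have "f ` {wavy_seq t0 g m..b} = g ` {wavy_seq t0 g m..b}"
      by (rule image_cong[OF refl])
    then show ?thesis
      by (simp add: osc_def)
  qed
  have C1: "C1_from t0 f = C1_from t0 g"
    using eq by (rule C1_from_cong)
  have next_eq: "wavy_next t0 f n (wavy_seq t0 g n) = wavy_next t0 g n (wavy_seq t0 g n)" for n
    using eq ge by (rule wavy_next_cong)
  have deriv: "deriv_from t0 f t0 = deriv_from t0 g t0"
    using eq order_refl by (rule deriv_from_cong)
  have seq_fun: "wavy_seq t0 f = wavy_seq t0 g"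
    using seq by auto
  show ?thesis
    using wavy unfolding wavy_function_with_def seq_fun osc C1 next_eq deriv
    by (auto simp: eq simp del: wavy_seq.simps)
qed

section \<open>Box dimension from the volume of neighbourhoods\<close>

text \<open>
  A volume of exact order \<open>\<epsilon> powr (N - d)\<close> makes the normalised volume of order \<open>\<epsilon> powr (s - d)\<close>.
  It tends to zero for \<open>s > d\<close> and stays away from zero for \<open>s \<le> d\<close>.
\<close>

lemma has_box_dim_if_nbhd_bounds:
  fixes A :: "'a::euclidean_space set" and c C d :: real
  assumes "bounded A" and d: "0 \<le> d" and c: "0 < c"
    and lower: "\<forall>\<^sub>F \<epsilon> in at_right 0. ennreal (c * \<epsilon> powr (real DIM('a) - d)) \<le> emeasure lebesgue (nbhd A \<epsilon>)"
    and upper: "\<forall>\<^sub>F \<epsilon> in at_right 0. emeasure lebesgue (nbhd A \<epsilon>) \<le> ennreal (C * \<epsilon> powr (real DIM('a) - d))"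
  shows "has_box_dim A d"
proof -
  define q where "q s \<epsilon> = emeasure lebesgue (nbhd A \<epsilon>) / ennreal (\<epsilon> powr (real DIM('a) - s))" for s \<epsilon>
  have nontrivial: "at_right (0::real) \<noteq> bot"
    by simp
  have small: "\<forall>\<^sub>F \<epsilon> in at_right (0::real). 0 < \<epsilon> \<and> \<epsilon> < 1"
    using eventually_at_right_real[of 0 1] by simp
  have content_le: "lower_minkowski_content s A \<le> upper_minkowski_content s A" for s
    unfolding lower_minkowski_content_def upper_minkowski_content_def
    by (rule Liminf_le_Limsup[OF nontrivial])
  have upper_zero: "upper_minkowski_content s A = 0" if "s > d" for s
  proof -
    have le: "\<forall>\<^sub>F \<epsilon> in at_right 0. q s \<epsilon> \<le> ennreal (C * \<epsilon> powr (s - d))"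
      using upper small
    proof eventually_elim
      case (elim \<epsilon>)
      have "q s \<epsilon> \<le> ennreal (C * \<epsilon> powr (real DIM('a) - d)) / ennreal (\<epsilon> powr (real DIM('a) - s))"
        unfolding q_def using elim by (intro divide_right_mono_ennreal) auto
      also have "\<dots> \<le> ennreal (C * \<epsilon> powr (real DIM('a) - d) / \<epsilon> powr (real DIM('a) - s))"
        using elim by (cases "C \<ge> 0") (simp_all add: divide_ennreal ennreal_neg mult_nonpos_nonneg)
      also have "C * \<epsilon> powr (real DIM('a) - d) / \<epsilon> powr (real DIM('a) - s) = C * \<epsilon> powr (s - d)"
        using elim by (simp add: powr_diff)
      finally show ?case .
    qed
    have "((\<lambda>\<epsilon>. C * \<epsilon> powr (s - d)) \<longlongrightarrow> 0) (at_right 0)"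
      using that by real_asymp
    then have "((\<lambda>\<epsilon>. ennreal (C * \<epsilon> powr (s - d))) \<longlongrightarrow> ennreal 0) (at_right 0)"
      by (rule tendsto_ennrealI)
    then have "Limsup (at_right 0) (\<lambda>\<epsilon>. ennreal (C * \<epsilon> powr (s - d))) = 0"
      using lim_imp_Limsup[OF nontrivial] by fastforce
    then show ?thesis
      using Limsup_mono[OF le] by (simp add: upper_minkowski_content_def q_def)
  qed
  have lower_pos: "lower_minkowski_content s A \<noteq> 0" if "s \<le> d" for s
  proof -
    have "\<forall>\<^sub>F \<epsilon> in at_right 0. ennreal c \<le> q s \<epsilon>"
      using lower small
    proof eventually_elim
      case (elim \<epsilon>)
      have "\<epsilon> powr 0 \<le> \<epsilon> powr (s - d)"
        using elim that by (intro powr_mono') auto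
      then have "c \<le> c * \<epsilon> powr (s - d)"
        using elim c by simp
      also have "\<dots> = c * \<epsilon> powr (real DIM('a) - d) / \<epsilon> powr (real DIM('a) - s)"
        using elim by (simp add: powr_diff)
      finally have "ennreal c \<le> ennreal (c * \<epsilon> powr (real DIM('a) - d)) / ennreal (\<epsilon> powr (real DIM('a) - s))"
        using elim c by (simp add: divide_ennreal ennreal_leI)
      also have "\<dots> \<le> q s \<epsilon>"
        unfolding q_def using elim by (intro divide_right_mono_ennreal) auto
      finally show ?case .
    qed
    then have "ennreal c \<le> lower_minkowski_content s A"
      unfolding lower_minkowski_content_def q_def by (rule Liminf_bounded)
    then show ?thesis
      using c by auto
  qed
  have "{s. 0 \<le> s \<and> upper_minkowski_content s A = 0} = {d<..}"
    using d upper_zero lower_pos content_le by (auto simp: not_less[symmetric]) (metis le_zero_eq not_le)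
  moreover have "{s. 0 \<le> s \<and> lower_minkowski_content s A = 0} = {d<..}"
    using d upper_zero lower_pos content_le by (auto simp: not_less[symmetric]) (metis le_zero_eq not_le)+
  ultimately show ?thesis
    using \<open>bounded A\<close> by (simp add: has_box_dim_def lower_box_dim_def upper_box_dim_def)
qed

lemma mem_nbhd_iff:
  assumes "A \<noteq> {}"
  shows "y \<in> nbhd A \<epsilon> \<longleftrightarrow> (\<exists>a\<in>A. dist y a < \<epsilon>)"
proof -
  have "bdd_below (dist y ` A)"
    by (rule bdd_belowI2[of _ 0]) simp
  with assms show ?thesis
    by (simp add: nbhd_def infdist_notempty cINF_less_iff)
qed

lemma open_nbhd: "open (nbhd A \<epsilon>)"
  unfolding nbhd_def by (intro open_Collect_less continuous_intros)

text \<open>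
  The function \<open>h\<close> plays the role of arc length. Points whose values of \<open>h\<close> share the same integer part
  of \<open>h / \<epsilon>\<close> are closer than \<open>\<epsilon>\<close>, so one representative for each integer part suffices.
\<close>

lemma finite_net_of_arc_length:
  fixes g :: "'b \<Rightarrow> 'a::metric_space"
  assumes h: "\<And>x. x \<in> S \<Longrightarrow> 0 \<le> h x \<and> h x \<le> H" and "0 \<le> H"
    and lip: "\<And>x y. x \<in> S \<Longrightarrow> y \<in> S \<Longrightarrow> dist (g x) (g y) \<le> \<bar>h x - h y\<bar>" and \<epsilon>: "0 < \<epsilon>"
  obtains F where "finite F" and "real (card F) \<le> H / \<epsilon> + 1" and "g ` S \<subseteq> (\<Union>p\<in>F. ball p \<epsilon>)"
proof -
  define j where "j x = nat \<lfloor>h x / \<epsilon>\<rfloor>" for x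
  define rep where "rep k = (SOME x. x \<in> S \<and> j x = k)" for k
  define F where "F = (g \<circ> rep) ` (j ` S)"
  have rep: "rep (j x) \<in> S \<and> j (rep (j x)) = j x" if "x \<in> S" for x
    unfolding rep_def by (rule someI[of _ x]) (use that in simp)
  have j_le: "j ` S \<subseteq> {..nat \<lfloor>H / \<epsilon>\<rfloor>}"
    using h \<epsilon> by (auto simp: j_def intro!: nat_mono floor_mono divide_right_mono)
  then have fin: "finite (j ` S)"
    by (rule finite_subset) simp
  have "card F \<le> card (j ` S)"
    unfolding F_def using fin by (rule card_image_le)
  also have "\<dots> \<le> nat \<lfloor>H / \<epsilon>\<rfloor> + 1"
    using card_mono[OF _ j_le] by simp
  finally have "real (card F) \<le> real (nat \<lfloor>H / \<epsilon>\<rfloor>) + 1"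
    by linarith
  also have "real (nat \<lfloor>H / \<epsilon>\<rfloor>) \<le> H / \<epsilon>"
    using \<open>0 \<le> H\<close> \<epsilon> by simp
  finally have card: "real (card F) \<le> H / \<epsilon> + 1"
    by simp
  have "g ` S \<subseteq> (\<Union>p\<in>F. ball p \<epsilon>)"
  proof (rule image_subsetI)
    fix x assume x: "x \<in> S"
    let ?y = "rep (j x)"
    have y: "?y \<in> S" "j ?y = j x"
      using rep[OF x] by auto
    have "\<lfloor>h ?y / \<epsilon>\<rfloor> = \<lfloor>h x / \<epsilon>\<rfloor>"
      using y(2) h[OF x] h[OF y(1)] \<epsilon> by (simp add: j_def eq_nat_nat_iff)
    then have "\<bar>h ?y / \<epsilon> - h x / \<epsilon>\<bar> < 1"
      by linarith
    then have "\<bar>h ?y - h x\<bar> < \<epsilon>"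
      using \<epsilon> by (simp flip: diff_divide_distrib add: abs_divide)
    then have "dist (g ?y) (g x) < \<epsilon>"
      using lip[OF y(1) x] by linarith
    then show "g x \<in> (\<Union>p\<in>F. ball p \<epsilon>)"
      using x by (auto simp: F_def)
  qed
  with fin card show thesis
    by (intro that[of F]) (simp_all add: F_def)
qed

lemma emeasure_disc:
  fixes c :: complex
  assumes "0 \<le> R"
  shows "emeasure lebesgue (ball c R) = ennreal (pi * R\<^sup>2)"
  using emeasure_ball[OF assms, of c] by (simp add: unit_ball_vol_2)

lemma emeasure_discs_le:
  fixes F :: "complex set"
  assumes "finite F" and "0 \<le> R"
  shows "emeasure lebesgue (\<Union>p\<in>F. ball p R) \<le> ennreal (card F * (pi * R\<^sup>2))"
proof -
  have "emeasure lebesgue (\<Union>p\<in>F. ball p R) \<le> (\<Sum>p\<in>F. emeasure lebesgue (ball p R))"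
    using assms by (intro emeasure_subadditive_finite) auto
  also have "\<dots> = ennreal (card F * (pi * R\<^sup>2))"
    using assms by (simp only: emeasure_disc sum_constant)
      (simp add: ennreal_mult' ennreal_of_nat_eq_real_of_nat)
  finally show ?thesis .
qed

section \<open>Spirals of power type\<close>

lemma eventually_le_powr_at_right:
  fixes B e P :: real
  assumes "0 < B" and "0 < e"
  shows "\<forall>\<^sub>F \<epsilon> in at_right 0. P \<le> (B / \<epsilon>) powr e"
proof -
  have "filterlim (\<lambda>\<epsilon>. (B / \<epsilon>) powr e) at_top (at_right 0)"
    using assms by real_asymp
  then show ?thesis
    by (simp add: filterlim_at_top)
qed

locale power_spiral =
  fixes x0 \<alpha> m_lower m_upper M :: real and f :: "real \<Rightarrow> real"
  assumes x0: "0 < x0" and \<alpha>: "0 < \<alpha>" "\<alpha> < 1" and m_lower: "0 < m_lower" and M: "0 < M"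
    and f_bounds: "\<And>x. x0 \<le> x \<Longrightarrow> m_lower * x powr - \<alpha> \<le> f x \<and> f x \<le> m_upper * x powr - \<alpha>"
    and f_diff: "f differentiable_on {x0..}"
    and deriv_bound: "\<And>x. x0 \<le> x \<Longrightarrow> \<bar>deriv_from x0 f x\<bar> \<le> M * x powr (- \<alpha> - 1)"
begin

abbreviation "curve x \<equiv> rcis (f x) x"

abbreviation "spiral_set \<equiv> polar_curve x0 f"

lemma f_pos: "x0 \<le> x \<Longrightarrow> 0 < f x"
  using f_bounds[of x] x0 m_lower by (smt (verit) mult_pos_pos powr_gt_zero)

lemma m_upper_pos: "0 < m_upper"
  using f_pos[of x0] f_bounds[of x0] by (smt (verit) mult_nonpos_nonneg powr_ge_zero)

lemma f_le: "x0 \<le> y \<Longrightarrow> y \<le> x \<Longrightarrow> f x \<le> m_upper * y powr - \<alpha>"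
proof -
  assume xy: "x0 \<le> y" "y \<le> x"
  have "m_upper * x powr - \<alpha> \<le> m_upper * y powr - \<alpha>"
    using xy x0 \<alpha> m_upper_pos by (intro mult_left_mono powr_mono2') auto
  then show ?thesis
    using f_bounds[of x] xy by linarith
qed

lemma exponent: "\<alpha> / (1 + \<alpha>) + \<alpha> / (1 + \<alpha>) = 2 - 2 / (1 + \<alpha>)"
proof -
  have "\<alpha> / (1 + \<alpha>) = 1 - 1 / (1 + \<alpha>)"
    using \<alpha> by (simp add: field_simps)
  then show ?thesis
    by simp
qed

lemma cont_f: "continuous_on {x0..} f"
  using f_diff by (rule differentiable_imp_continuous_on)

lemma has_vector_derivative_f:
  assumes "x0 < x"
  shows "(f has_vector_derivative deriv_from x0 f x) (at x)"
proof -
  have "at x within {x0..} = at x"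
    using assms by (intro at_within_interior) simp
  moreover have "f differentiable (at x within {x0..})"
    using f_diff assms by (simp add: differentiable_on_def)
  ultimately show ?thesis
    unfolding deriv_from_def using vector_derivative_works by metis
qed

lemma radial_drop:
  assumes "x0 \<le> x" and "x \<le> y"
  shows "f x - f y \<le> M * x powr (- \<alpha> - 1) * (y - x)"
proof (cases "x = y")
  case False
  then have "x < y"
    using assms by simp
  define m where "m = M * x powr (- \<alpha> - 1)"
  have "norm (f y - f x) \<le> m * y - m * x"
  proof (rule differentiable_bound_general[OF \<open>x < y\<close>, where f' = "deriv_from x0 f" and \<phi>' = "\<lambda>_. m"])
    show "continuous_on {x..y} f"
      using continuous_on_subset[OF cont_f] assms by auto
    show "norm (deriv_from x0 f u) \<le> m" if "x < u" "u < y" for u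
    proof -
      have "u powr (- \<alpha> - 1) \<le> x powr (- \<alpha> - 1)"
        using that assms x0 \<alpha> by (intro powr_mono2') auto
      then have "M * u powr (- \<alpha> - 1) \<le> m"
        using M by (simp add: m_def)
      then show ?thesis
        using deriv_bound[of u] that assms by simp
    qed
    show "(f has_vector_derivative deriv_from x0 f u) (at u)" if "x < u" "u < y" for u
      using that assms by (intro has_vector_derivative_f) simp
    show "((\<lambda>u. m * u) has_vector_derivative m) (at u)" for u
      by (auto intro!: derivative_eq_intros simp flip: has_real_derivative_iff_has_vector_derivative)
  qed (intro continuous_intros)
  then show ?thesis
    by (simp add: m_def right_diff_distrib)
qed simp

text \<open>
  The velocity of the curve at the angle \<open>x\<close> has norm at most \<open>\<bar>f' x\<bar> + f x\<close>. Since \<open>x powr (- \<alpha> - 1)\<close>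
  is at most \<open>x powr - \<alpha> / x0\<close>, this is at most \<open>(M / x0 + m_upper) * x powr - \<alpha>\<close>, the derivative
  of \<open>arc_bound\<close>.
\<close>

definition arc_bound :: "real \<Rightarrow> real" where
  "arc_bound x = (M / x0 + m_upper) / (1 - \<alpha>) * x powr (1 - \<alpha>)"

lemma dist_curve_le_arc:
  assumes "x0 \<le> x" and "x \<le> y"
  shows "dist (curve y) (curve x) \<le> arc_bound y - arc_bound x"
proof (cases "x = y")
  case False
  then have "x < y"
    using assms by simp
  let ?v = "\<lambda>u. of_real (f u) * (\<i> * cis u) + of_real (deriv_from x0 f u) * cis u"
  have "norm (curve y - curve x) \<le> arc_bound y - arc_bound x"
  proof (rule differentiable_bound_general[OF \<open>x < y\<close>, where f' = ?v
          and \<phi>' = "\<lambda>u. (M / x0 + m_upper) * u powr - \<alpha>"])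
    have "continuous_on {x..y} f"
      using continuous_on_subset[OF cont_f] assms by auto
    then show "continuous_on {x..y} (\<lambda>u. curve u)"
      by (intro continuous_intros)
    show "continuous_on {x..y} arc_bound"
      unfolding arc_bound_def using assms x0 by (intro continuous_intros) auto
    fix u assume u: "x < u" "u < y"
    have cis: "(cis has_vector_derivative \<i> * cis u) (at u)"
      unfolding has_vector_derivative_def
      by (rule has_derivative_eq_rhs[OF has_derivative_cis[OF has_derivative_ident]])
        (simp add: fun_eq_iff)
    have "((\<lambda>u. of_real (f u) :: complex) has_vector_derivative of_real (deriv_from x0 f u)) (at u)"
      using has_vector_derivative_f[of u] u assms
      by (simp add: has_vector_derivative_of_real has_real_derivative_iff_has_vector_derivative)
    from has_vector_derivative_mult[OF this cis]
    show "((\<lambda>u. curve u) has_vector_derivative ?v u) (at u)"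
      by (simp add: rcis_def)
    have "((\<lambda>u. u powr (1 - \<alpha>)) has_real_derivative (1 - \<alpha>) * u powr - \<alpha>) (at u)"
      using u assms x0 has_real_derivative_powr[of u "1 - \<alpha>"] by simp
    from DERIV_cmult[OF this, of "(M / x0 + m_upper) / (1 - \<alpha>)"]
    have "(arc_bound has_real_derivative (M / x0 + m_upper) * u powr - \<alpha>) (at u)"
      using \<alpha> by (simp add: arc_bound_def[abs_def])
    then show "(arc_bound has_vector_derivative (M / x0 + m_upper) * u powr - \<alpha>) (at u)"
      by (simp add: has_real_derivative_iff_has_vector_derivative)
    have "norm (?v u) \<le> norm (of_real (f u) * (\<i> * cis u)) + norm (of_real (deriv_from x0 f u) * cis u)"
      by (rule norm_triangle_ineq)
    also have "\<dots> = f u + \<bar>deriv_from x0 f u\<bar>"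
      using f_pos[of u] u assms by (simp add: norm_mult)
    also have "\<dots> \<le> m_upper * u powr - \<alpha> + M * u powr (- \<alpha> - 1)"
      using f_bounds[of u] deriv_bound[of u] u assms by simp
    also have "u powr (- \<alpha> - 1) = u powr - \<alpha> / u"
      using u assms x0 by (simp add: powr_diff)
    also have "u powr - \<alpha> / u \<le> u powr - \<alpha> / x0"
      using u assms x0 by (intro divide_left_mono) auto
    finally show "norm (?v u) \<le> (M / x0 + m_upper) * u powr - \<alpha>"
      using M by (simp add: algebra_simps)
  qed
  then show ?thesis
    by (simp add: dist_norm)
qed simp

lemma arc_nonneg: "0 \<le> arc_bound x"
  using M m_upper_pos x0 \<alpha> by (simp add: arc_bound_def)

lemma arc_mono: "x0 \<le> x \<Longrightarrow> x \<le> y \<Longrightarrow> arc_bound x \<le> arc_bound y"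
  using dist_curve_le_arc[of x y] zero_le_dist[of "curve y" "curve x"] by linarith

lemma bounded_spiral: "bounded spiral_set"
proof (rule boundedI)
  show "norm z \<le> m_upper * x0 powr - \<alpha>" if "z \<in> spiral_set" for z
    using that f_le[of x0] f_pos by (force simp: polar_curve_def)
qed

lemma spiral_nonempty: "spiral_set \<noteq> {}"
  by (auto simp: polar_curve_def)

text \<open>
  The tail up to the angle \<open>T\<close> is covered through a net of its curve, the nucleus beyond \<open>T\<close> by one disc.
\<close>

lemma emeasure_nbhd_le:
  assumes T: "x0 \<le> T" and \<epsilon>: "0 < \<epsilon>"
  shows "emeasure lebesgue (nbhd spiral_set \<epsilon>)
    \<le> ennreal ((arc_bound T / \<epsilon> + 1) * (pi * (2 * \<epsilon>)\<^sup>2) + pi * (m_upper * T powr - \<alpha> + \<epsilon>)\<^sup>2)"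
proof -
  define R where "R = m_upper * T powr - \<alpha> + \<epsilon>"
  have R: "0 \<le> R"
    using m_upper_pos \<epsilon> by (simp add: R_def)
  have lip: "dist (curve x) (curve y) \<le> \<bar>arc_bound x - arc_bound y\<bar>" if "x \<in> {x0..T}" "y \<in> {x0..T}" for x y
    using that dist_curve_le_arc[of x y] dist_curve_le_arc[of y x]
    by (cases "x \<le> y") (auto simp: dist_commute)
  have range: "0 \<le> arc_bound x \<and> arc_bound x \<le> arc_bound T" if "x \<in> {x0..T}" for x
    using that arc_nonneg arc_mono by auto
  obtain F where F: "finite F" "real (card F) \<le> arc_bound T / \<epsilon> + 1"
      "(\<lambda>x. curve x) ` {x0..T} \<subseteq> (\<Union>p\<in>F. ball p \<epsilon>)"
    by (rule finite_net_of_arc_length[where g = "\<lambda>x. curve x", OF range arc_nonneg lip \<epsilon>])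
  have "nbhd spiral_set \<epsilon> \<subseteq> (\<Union>p\<in>F. ball p (2 * \<epsilon>)) \<union> ball 0 R"
  proof
    fix z assume "z \<in> nbhd spiral_set \<epsilon>"
    then obtain x where x: "x0 \<le> x" "dist z (curve x) < \<epsilon>"
      unfolding mem_nbhd_iff[OF spiral_nonempty] by (auto simp: polar_curve_def)
    show "z \<in> (\<Union>p\<in>F. ball p (2 * \<epsilon>)) \<union> ball 0 R"
    proof (cases "x \<le> T")
      case True
      then have "curve x \<in> (\<Union>p\<in>F. ball p \<epsilon>)"
        using x(1) by (intro subsetD[OF F(3)] imageI) simp
      then obtain p where "p \<in> F" "dist p (curve x) < \<epsilon>"
        by auto
      with x(2) have "dist p z < 2 * \<epsilon>"
        using dist_triangle3[of p z "curve x"] by (simp add: dist_commute)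
      with \<open>p \<in> F\<close> show ?thesis
        by auto
    next
      case False
      have "norm (curve x) \<le> m_upper * T powr - \<alpha>"
        using f_le[OF T, of x] f_pos[of x] x False by simp
      moreover have "norm z \<le> dist z (curve x) + norm (curve x)"
        using dist_triangle[of z 0 "curve x"] by simp
      ultimately show ?thesis
        using x(2) by (simp add: R_def)
    qed
  qed
  then have "emeasure lebesgue (nbhd spiral_set \<epsilon>)
      \<le> emeasure lebesgue ((\<Union>p\<in>F. ball p (2 * \<epsilon>)) \<union> ball 0 R)"
    by (intro emeasure_mono) (simp_all add: borel_open open_UN open_Un)
  also have "\<dots> \<le> emeasure lebesgue (\<Union>p\<in>F. ball p (2 * \<epsilon>)) + emeasure lebesgue (ball 0 R :: complex set)"
    by (intro emeasure_subadditive) (simp_all add: borel_open open_UN)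
  also have "\<dots> \<le> ennreal (card F * (pi * (2 * \<epsilon>)\<^sup>2)) + ennreal (pi * R\<^sup>2)"
    using emeasure_discs_le[OF F(1), of "2 * \<epsilon>"] emeasure_disc[OF R, of 0] \<epsilon> by (intro add_mono) auto
  also have "\<dots> = ennreal (card F * (pi * (2 * \<epsilon>)\<^sup>2) + pi * R\<^sup>2)"
    by simp
  also have "\<dots> \<le> ennreal ((arc_bound T / \<epsilon> + 1) * (pi * (2 * \<epsilon>)\<^sup>2) + pi * R\<^sup>2)"
    using F(2) by (intro ennreal_leI add_right_mono mult_right_mono) auto
  finally show ?thesis
    by (simp add: R_def)
qed

text \<open>
  With \<open>T = \<epsilon> powr (- 1 / (1 + \<alpha>))\<close>, the area of the tail and that of the nucleus balance.
\<close>

lemma nbhd_upper: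
  "\<exists>C. \<forall>\<^sub>F \<epsilon> in at_right 0.
     emeasure lebesgue (nbhd spiral_set \<epsilon>) \<le> ennreal (C * \<epsilon> powr (2 - 2 / (1 + \<alpha>)))"
proof -
  define K where "K = (M / x0 + m_upper) / (1 - \<alpha>)"
  define C where "C = 4 * pi * (K + 1) + pi * (m_upper + 1)\<^sup>2"
  have large: "\<forall>\<^sub>F \<epsilon> in at_right 0. x0 \<le> (1 / \<epsilon>) powr (1 / (1 + \<alpha>))"
    using \<alpha> by (intro eventually_le_powr_at_right) auto
  have small: "\<forall>\<^sub>F \<epsilon> in at_right (0::real). 0 < \<epsilon> \<and> \<epsilon> < 1"
    using eventually_at_right_real[of 0 1] by simp
  have "\<forall>\<^sub>F \<epsilon> in at_right 0.
      emeasure lebesgue (nbhd spiral_set \<epsilon>) \<le> ennreal (C * \<epsilon> powr (2 - 2 / (1 + \<alpha>)))"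
    using large small
  proof eventually_elim
    case (elim \<epsilon>)
    define T where "T = (1 / \<epsilon>) powr (1 / (1 + \<alpha>))"
    define E where "E = \<epsilon> powr (2 - 2 / (1 + \<alpha>))"
    have \<epsilon>: "0 < \<epsilon>" "\<epsilon> < 1"
      using elim by auto
    have T: "T powr b = \<epsilon> powr (- b / (1 + \<alpha>))" for b
      unfolding T_def using \<epsilon> by (simp add: powr_powr powr_divide powr_minus_divide)
    have tail: "\<epsilon> * T powr (1 - \<alpha>) = E"
    proof -
      have "\<epsilon> * T powr (1 - \<alpha>) = \<epsilon> powr (1 + - (1 - \<alpha>) / (1 + \<alpha>))"
        unfolding T powr_add using \<epsilon> by simp
      also have "1 + - (1 - \<alpha>) / (1 + \<alpha>) = 2 - 2 / (1 + \<alpha>)"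
        using \<alpha> by (simp add: field_simps)
      finally show ?thesis
        by (simp add: E_def)
    qed
    have nucleus: "(T powr - \<alpha>)\<^sup>2 = E"
    proof -
      have "(T powr - \<alpha>)\<^sup>2 = \<epsilon> powr (\<alpha> / (1 + \<alpha>) + \<alpha> / (1 + \<alpha>))"
        unfolding T power2_eq_square powr_add by simp
      also note exponent
      finally show ?thesis
        by (simp add: E_def)
    qed
    have "\<epsilon> powr 1 \<le> \<epsilon> powr (\<alpha> / (1 + \<alpha>))"
      using \<epsilon> \<alpha> by (intro powr_mono') auto
    then have \<epsilon>_le: "\<epsilon> \<le> T powr - \<alpha>"
      using \<epsilon> by (simp add: T)
    then have \<epsilon>_sq: "\<epsilon>\<^sup>2 \<le> E"
      using \<epsilon> unfolding nucleus[symmetric] by (intro power_mono) auto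
    have "arc_bound T = K * T powr (1 - \<alpha>)"
      by (simp add: arc_bound_def K_def)
    then have "(arc_bound T / \<epsilon> + 1) * (pi * (2 * \<epsilon>)\<^sup>2) = 4 * pi * (K * (\<epsilon> * T powr (1 - \<alpha>)) + \<epsilon>\<^sup>2)"
      using \<epsilon> by (simp add: field_simps power2_eq_square)
    also have "\<dots> \<le> 4 * pi * (K * E + E)"
      unfolding tail using \<epsilon>_sq by simp
    finally have 1: "(arc_bound T / \<epsilon> + 1) * (pi * (2 * \<epsilon>)\<^sup>2) \<le> 4 * pi * (K + 1) * E"
      by (simp add: algebra_simps)
    have "(m_upper * T powr - \<alpha> + \<epsilon>)\<^sup>2 \<le> ((m_upper + 1) * T powr - \<alpha>)\<^sup>2"
      using \<epsilon> \<epsilon>_le m_upper_pos by (intro power_mono) (auto simp: algebra_simps)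
    also have "\<dots> = (m_upper + 1)\<^sup>2 * E"
      by (simp add: power_mult_distrib nucleus)
    finally have 2: "pi * (m_upper * T powr - \<alpha> + \<epsilon>)\<^sup>2 \<le> pi * (m_upper + 1)\<^sup>2 * E"
      by simp
    have "(arc_bound T / \<epsilon> + 1) * (pi * (2 * \<epsilon>)\<^sup>2) + pi * (m_upper * T powr - \<alpha> + \<epsilon>)\<^sup>2 \<le> C * E"
      using 1 2 unfolding C_def distrib_right[of "4 * pi * (K + 1)"] by linarith
    moreover have "x0 \<le> T"
      using elim by (simp add: T_def)
    ultimately show ?case
      using emeasure_nbhd_le[of T \<epsilon>] \<epsilon> unfolding E_def[symmetric] by (meson ennreal_leI order_trans)
  qed
  then show ?thesis
    by blast
qed

text \<open>
  A point in the disc is at an angle in \<open>[T, T + 2 * pi]\<close>, and the curve starts beyond it on the ray at this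
  angle. Going inwards along the ray turn by turn, the first turn that passes the point misses it by at most
  one gap.
\<close>

lemma disc_subset_nbhd:
  assumes T: "x0 \<le> T" and gap: "M * T powr (- \<alpha> - 1) * (2 * pi) < \<epsilon>"
  shows "ball 0 (m_lower * (T + 2 * pi) powr - \<alpha>) \<subseteq> nbhd spiral_set \<epsilon>"
proof
  fix z :: complex
  assume z: "z \<in> ball 0 (m_lower * (T + 2 * pi) powr - \<alpha>)"
  define n where "n = \<lceil>(T - Arg z) / (2 * pi)\<rceil>"
  define x where "x = Arg z + 2 * pi * of_int n"
  have "(T - Arg z) / (2 * pi) \<le> of_int n" "of_int n \<le> (T - Arg z) / (2 * pi) + 1"
    unfolding n_def by linarith+
  then have x: "T \<le> x" "x \<le> T + 2 * pi"
    by (simp_all add: x_def field_simps)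
  define turn where "turn k = x + 2 * pi * real k" for k
  have turn_ge: "x \<le> turn k" for k
    by (simp add: turn_def)
  have cis_turn: "cis (turn k) = cis (Arg z)" for k
  proof -
    have "cis (turn k) = cis (Arg z) * cis (2 * pi * of_int n) * cis (2 * pi * real k)"
      unfolding turn_def x_def cis_mult ..
    then show ?thesis
      by simp
  qed
  have z_polar: "z = rcis (norm z) (turn k)" for k
    unfolding rcis_def cis_turn using rcis_cmod_Arg[of z] by (simp add: rcis_def)
  have "norm z < m_lower * (T + 2 * pi) powr - \<alpha>"
    using z by simp
  also have "\<dots> \<le> m_lower * x powr - \<alpha>"
    using x T x0 m_lower \<alpha> by (intro mult_left_mono powr_mono2') auto
  also have "\<dots> \<le> f x"
    using f_bounds[of x] x T by simp
  finally have first: "norm z < f (turn 0)"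
    by (simp add: turn_def)
  have near: "\<exists>k. \<bar>norm z - f (turn k)\<bar> < \<epsilon>"
  proof (cases "\<exists>k. f (turn k) \<le> norm z")
    case True
    define k where "k = (LEAST k. f (turn k) \<le> norm z)"
    have k: "f (turn k) \<le> norm z"
      unfolding k_def using True by (rule LeastI_ex)
    then obtain l where l: "k = Suc l"
      using first by (cases k) auto
    have "norm z < f (turn l)"
      using not_less_Least[of l "\<lambda>k. f (turn k) \<le> norm z"] l by (simp add: k_def)
    moreover have "f (turn l) - f (turn k) < \<epsilon>"
    proof -
      have "f (turn l) - f (turn k) \<le> M * turn l powr (- \<alpha> - 1) * (turn k - turn l)"
      proof (rule radial_drop)
        show "x0 \<le> turn l"
          using turn_ge[of l] x T by linarith
        show "turn l \<le> turn k"
          by (simp add: turn_def l)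
      qed
      also have "turn k - turn l = 2 * pi"
        by (simp add: turn_def l algebra_simps)
      also have "M * turn l powr (- \<alpha> - 1) * (2 * pi) \<le> M * T powr (- \<alpha> - 1) * (2 * pi)"
        using turn_ge[of l] x T x0 M \<alpha> by (intro mult_right_mono mult_left_mono powr_mono2') auto
      finally show ?thesis
        using gap by simp
    qed
    ultimately show ?thesis
      using k by (intro exI[of _ k]) auto
  next
    \<comment> \<open>The radii along the ray tend to zero, so the curve comes close to the origin, and \<open>z\<close> is closer still.\<close>
    case False
    have "filterlim turn at_top sequentially"
      unfolding turn_def by real_asymp
    moreover have "((\<lambda>y. m_upper * y powr - \<alpha>) \<longlongrightarrow> 0) at_top"
      using \<alpha> by real_asymp
    ultimately have "(\<lambda>k. m_upper * turn k powr - \<alpha>) \<longlonglongrightarrow> 0"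
      by (rule filterlim_compose[rotated])
    moreover have "0 < \<epsilon>"
      using gap M T x0 by (smt (verit) mult_nonneg_nonneg pi_ge_zero powr_ge_zero)
    ultimately have "\<forall>\<^sub>F k in sequentially. m_upper * turn k powr - \<alpha> < \<epsilon>"
      by (rule order_tendstoD(2))
    then obtain k where k: "m_upper * turn k powr - \<alpha> < \<epsilon>"
      by (auto simp: eventually_sequentially)
    then have "f (turn k) < \<epsilon>"
      using f_bounds[of "turn k"] turn_ge[of k] x T by simp
    moreover have "norm z < f (turn k)"
      using False by (simp add: not_le)
    ultimately show ?thesis
      by (intro exI[of _ k]) (auto simp: abs_if intro: le_less_trans[of _ "f (turn k)"])
  qed
  then obtain k where k: "\<bar>norm z - f (turn k)\<bar> < \<epsilon>"
    by blast
  have "z - curve (turn k) = rcis (norm z - f (turn k)) (turn k)"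
    by (subst z_polar[of k]) (simp add: rcis_def left_diff_distrib)
  then have "dist z (curve (turn k)) = \<bar>norm z - f (turn k)\<bar>"
    by (simp add: dist_norm)
  moreover have "curve (turn k) \<in> spiral_set"
    using turn_ge[of k] x T by (auto simp: polar_curve_def)
  ultimately show "z \<in> nbhd spiral_set \<epsilon>"
    unfolding mem_nbhd_iff[OF spiral_nonempty] using k by (intro bexI[of _ "curve (turn k)"]) simp_all
qed

lemma nbhd_lower:
  "\<exists>c>0. \<forall>\<^sub>F \<epsilon> in at_right 0.
     ennreal (c * \<epsilon> powr (2 - 2 / (1 + \<alpha>))) \<le> emeasure lebesgue (nbhd spiral_set \<epsilon>)"
proof -
  \<comment> \<open>The factor 4 instead of 2 makes the gaps beyond \<open>T\<close> at most half of \<open>\<epsilon>\<close>.\<close>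
  define B where "B = 4 * pi * M"
  have B: "0 < B"
    using M by (simp add: B_def)
  define c where "c = pi * (m_lower * 2 powr - \<alpha> * B powr (- \<alpha> / (1 + \<alpha>)))\<^sup>2"
  have c: "0 < c"
    using m_lower B by (simp add: c_def)
  have large: "\<forall>\<^sub>F \<epsilon> in at_right 0. max x0 (2 * pi) \<le> (B / \<epsilon>) powr (1 / (1 + \<alpha>))"
    using \<alpha> B by (intro eventually_le_powr_at_right) auto
  have "\<forall>\<^sub>F \<epsilon> in at_right 0.
      ennreal (c * \<epsilon> powr (2 - 2 / (1 + \<alpha>))) \<le> emeasure lebesgue (nbhd spiral_set \<epsilon>)"
    using large eventually_at_right_less[of 0]
  proof eventually_elim
    case (elim \<epsilon>)
    define T where "T = (B / \<epsilon>) powr (1 / (1 + \<alpha>))"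
    define R where "R = m_lower * (2 * T) powr - \<alpha>"
    have T: "x0 \<le> T" "2 * pi \<le> T"
      using elim by (auto simp: T_def)
    have "T powr (- \<alpha> - 1) = (B / \<epsilon>) powr (1 / (1 + \<alpha>) * (- \<alpha> - 1))"
      unfolding T_def by (rule powr_powr)
    also have "1 / (1 + \<alpha>) * (- \<alpha> - 1) = -1"
      using \<alpha> by (simp add: field_simps)
    finally have "T powr (- \<alpha> - 1) = \<epsilon> / B"
      using elim B by (simp add: powr_minus_divide)
    then have "M * T powr (- \<alpha> - 1) * (2 * pi) < \<epsilon>"
      using elim M by (simp add: B_def field_simps)
    then have "ball 0 (m_lower * (T + 2 * pi) powr - \<alpha>) \<subseteq> nbhd spiral_set \<epsilon>"
      by (rule disc_subset_nbhd[OF T(1)])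
    moreover have "R \<le> m_lower * (T + 2 * pi) powr - \<alpha>"
      unfolding R_def using T x0 m_lower \<alpha> pi_gt_zero
      by (intro mult_left_mono powr_mono2') linarith+
    ultimately have sub: "ball 0 R \<subseteq> nbhd spiral_set \<epsilon>"
      using subset_ball by blast
    have "T powr - \<alpha> = (B / \<epsilon>) powr (- \<alpha> / (1 + \<alpha>))"
      by (simp add: T_def powr_powr)
    also have "\<dots> = B powr (- \<alpha> / (1 + \<alpha>)) * \<epsilon> powr (\<alpha> / (1 + \<alpha>))"
      using elim B by (simp add: powr_divide powr_minus_divide)
    finally have "pi * R\<^sup>2 = c * (\<epsilon> powr (\<alpha> / (1 + \<alpha>)))\<^sup>2"
      using x0 T by (simp add: R_def c_def powr_mult power_mult_distrib)
    also have "(\<epsilon> powr (\<alpha> / (1 + \<alpha>)))\<^sup>2 = \<epsilon> powr (\<alpha> / (1 + \<alpha>) + \<alpha> / (1 + \<alpha>))"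
      by (simp only: power2_eq_square powr_add)
    also note exponent
    finally have area: "pi * R\<^sup>2 = c * \<epsilon> powr (2 - 2 / (1 + \<alpha>))" .
    have "emeasure lebesgue (ball 0 R :: complex set) \<le> emeasure lebesgue (nbhd spiral_set \<epsilon>)"
      using sub by (intro emeasure_mono) (simp_all add: open_nbhd borel_open)
    moreover have "0 \<le> R"
      using m_lower by (simp add: R_def)
    ultimately show ?case
      using emeasure_disc[of R 0] by (simp add: area)
  qed
  with c show ?thesis
    by blast
qed

theorem has_box_dim_spiral: "has_box_dim spiral_set (2 / (1 + \<alpha>))"
proof -
  obtain c where c: "0 < c" "\<forall>\<^sub>F \<epsilon> in at_right 0.
      ennreal (c * \<epsilon> powr (2 - 2 / (1 + \<alpha>))) \<le> emeasure lebesgue (nbhd spiral_set \<epsilon>)"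
    using nbhd_lower by blast
  obtain C where C: "\<forall>\<^sub>F \<epsilon> in at_right 0.
      emeasure lebesgue (nbhd spiral_set \<epsilon>) \<le> ennreal (C * \<epsilon> powr (2 - 2 / (1 + \<alpha>)))"
    using nbhd_upper by blast
  show ?thesis
    using \<alpha> c C bounded_spiral by (intro has_box_dim_if_nbhd_bounds[of _ _ c C]) simp_all
qed

end

section \<open>Wavy spirals\<close>

theorem theorem3:
  fixes t0 \<phi>0 \<phi>bar0 \<alpha> \<epsilon> \<epsilon>' \<theta> m_lower m_upper a_lower M :: real
    and r \<phi> f :: "real \<Rightarrow> real"
  assumes "t0 > 0"
    and "wavy_function_with t0 r \<epsilon> \<alpha>"
    and "C1_from t0 \<phi>"
    and "strict_mono_on {t0..} \<phi>"
    and "\<phi> t0 = \<phi>0"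
    and "\<phi>0 > 0"
    and "((\<lambda>t. \<bar>(\<phi> t - \<phi>bar0) - (t - t0)\<bar>) \<longlongrightarrow> 0) at_top"
    and "\<And>t. t \<ge> t0 \<Longrightarrow> f (\<phi> t) = r t"
    and "spiral \<phi>0 f"
    and "0 < \<epsilon>'"
    and "\<epsilon>' < \<epsilon>"
    and "\<theta> = min \<epsilon>' pi"
    and "m_lower > 0"
    and "m_upper > 0"
    and "a_lower > 0"
    and "M > 0"
    and "\<And>x. x \<ge> \<phi>0 \<Longrightarrow> m_lower * x powr (-\<alpha>) \<le> f x \<and> f x \<le> m_upper * x powr (-\<alpha>)"
    and "f differentiable_on {\<phi>0..}"
    and "\<And>x. x \<ge> \<phi>0 \<Longrightarrow> \<bar>deriv_from \<phi>0 f x\<bar> \<le> M * x powr (-\<alpha> - 1)"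
    and "\<And>x \<Delta>. x \<ge> \<phi>0 \<Longrightarrow> \<theta> \<le> \<Delta> \<Longrightarrow> \<Delta> \<le> 2 * pi + \<theta> \<Longrightarrow>
           a_lower * x powr (-\<alpha> - 1) \<le> f x - f (x + \<Delta>)"
  shows "wavy_spiral \<phi>0 f \<and> has_box_dim (polar_curve \<phi>0 f) (2 / (1 + \<alpha>))"
proof
  have \<alpha>: "0 < \<alpha>" "\<alpha> < 1"
    using assms(2) by (simp_all add: wavy_function_with_def)
  have "\<phi> t0 \<le> \<phi> t" if "t \<ge> t0" for t
    using strict_mono_on_leD[OF assms(4), of t0 t] that by simp
  then have "\<phi> ` {t0..} \<subseteq> {\<phi>0..}"
    using assms(5) by auto
  moreover have "wavy_function t0 (\<lambda>t. f (\<phi> t))"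
    unfolding wavy_function_def using wavy_function_with_cong[OF assms(8) assms(2)] by blast
  ultimately show "wavy_spiral \<phi>0 f"
    unfolding wavy_spiral_def using assms(3,4,9) by blast
  interpret power_spiral \<phi>0 \<alpha> m_lower m_upper M f
    using assms(6) \<alpha> assms(13) assms(16-19) by (rule power_spiral.intro)
  show "has_box_dim (polar_curve \<phi>0 f) (2 / (1 + \<alpha>))"
    by (rule has_box_dim_spiral)
qed

end
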